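(* Let $X$ be a normed space. Then the penalty function $F_\lambda=f+\lambda\varphi$ is (globally) exact if and only if the following two conditions are satisfied: (1) $F_\lambda$ is strongly non-degenerate; (2) for any $R>0$ there exist $\lambda^*\ge0$ and $r>0$ such that $$\frac{f^*-f(y)}{\varphi(y)}\le\lambda^*\quad\forall y\in\{x\in(A\cap B(0,R))\setminus\Omega\mid d(x,\Omega)<r\},$$ where $f^*=\inf_{x\in\Omega}f(x)$.
   Context: $M,A\subset X$ are nonempty, $f\colon X\to\mathbb{R}\cup\{+\infty\}$, $\varphi\colon X\to[0,+\infty)$ with $M=\{x\in X\mid\varphi(x)=0\}$, $\Omega=M\cap A$, $F_\lambda(x)=f(x)+\lambda\varphi(x)$ for $\lambda\ge0$. The problem $(\mathcal{P})$ is: $\min f(x)$ subject to $x\in M$, $x\in A$. Standing assumptions: $f(x)<+\infty$ for some $x\in\Omega$, and $f$ attains a global minimum on $\Omega$. $B(0,R)$ is the closed ball of radius $R$ centred at $0$, $d(x,\Omega)=\inf_{y\in\Omega}\|x-y\|$. $G(\lambda)$ denotes the (possibly empty) set of global minimizers of $F_\lambda$ on $A$. $F_\lambda$ is strongly non-degenerate if there exist $\lambda_0\ge0$ and a selection $x(\cdot)$ of $G(\cdot)$ (i.e. $x(\lambda)\in G(\lambda)$; in particular $G(\lambda)\neq\emptyset$ for all $\lambda\ge\lambda_0$) such that the set $\{x(\lambda)\mid\lambda\ge\lambda_0\}$ is bounded and $\liminf_{\lambda\to\infty}d(x(\lambda),\Omega)=0$. $F_\lambda$ is (globally) exact if there exists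 $\lambda_0\ge0$ such that for every $\lambda>\lambda_0$ the set of global minimizers of $F_\lambda$ on $A$ coincides with the set of globally optimal solutions of $(\mathcal{P})$. *)

theory Defs
  imports "HOL-Analysis.Analysis"
begin

text \<open>
  The objective takes values in the reals extended by plus infinity; it is modelled as a function
  into \<^typ>\<open>ereal\<close>, and statements about it must assume that minus infinity is not attained.
\<close>

definition penalty_fun :: "('a \<Rightarrow> ereal) \<Rightarrow> ('a \<Rightarrow> real) \<Rightarrow> real \<Rightarrow> 'a \<Rightarrow> ereal" where
  "penalty_fun f \<phi> l x = f x + ereal (l * \<phi> x)"

definition global_minimizers :: "('a \<Rightarrow> ereal) \<Rightarrow> 'a set \<Rightarrow> 'a set" where
  "global_minimizers g S = {x. is_arg_min g (\<lambda>y. y \<in> S) x}"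

definition strongly_nondegenerate ::
    "('a::real_normed_vector \<Rightarrow> ereal) \<Rightarrow> ('a \<Rightarrow> real) \<Rightarrow> 'a set \<Rightarrow> 'a set \<Rightarrow> bool" where
  "strongly_nondegenerate f \<phi> M A \<longleftrightarrow>
     (\<exists>l0\<ge>0. \<exists>x :: real \<Rightarrow> 'a.
        (\<forall>l\<ge>l0. x l \<in> global_minimizers (penalty_fun f \<phi> l) A) \<and>
        bounded {x l |l. l \<ge> l0} \<and>
        Liminf at_top (\<lambda>l. ereal (infdist (x l) (M \<inter> A))) = 0)"

definition globally_exact ::
    "('a \<Rightarrow> ereal) \<Rightarrow> ('a \<Rightarrow> real) \<Rightarrow> 'a set \<Rightarrow> 'a set \<Rightarrow> bool" where
  "globally_exact f \<phi> M A \<longleftrightarrow>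
     (\<exists>l0\<ge>0. \<forall>l>l0. global_minimizers (penalty_fun f \<phi> l) A = global_minimizers f (M \<inter> A))"

end

theory Submission
  imports Defs
begin

text \<open>
  Exactness is equivalent to the existence of a single parameter \<open>l\<close> for which \<open>fstar\<close> is a
  lower bound of the penalty function on \<open>A\<close>. For infeasible \<open>y\<close> this bound says exactly that
  the quotient in condition (2) is at most \<open>l\<close>, which gives one direction. Conversely, strong
  non-degeneracy provides arbitrarily large \<open>l\<close> whose minimizer lies in a fixed ball and within
  distance \<open>r\<close> of the feasible set; if it were infeasible, condition (2) would force its penalty
  value above \<open>fstar\<close>. So it is feasible, and the bound holds for this \<open>l\<close>.
\<close>

lemma global_minimizers_iff:
  "x \<in> global_minimizers g S \<longleftrightarrow> x \<in> S \<and> (\<forall>y\<in>S. g x \<le> g y)"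
  by (auto simp: global_minimizers_def is_arg_min_def not_less)

lemma global_minimizers_INF:
  assumes "x \<in> global_minimizers g S"
  shows "(INF y\<in>S. g y) = g x"
  using assms by (auto simp: global_minimizers_iff intro!: antisym INF_lower INF_greatest)

lemma penalty_fun_feasible [simp]:
  "\<phi> x = 0 \<Longrightarrow> penalty_fun f \<phi> l x = f x"
  by (simp add: penalty_fun_def zero_ereal_def[symmetric])

lemma penalty_fun_mono:
  assumes "0 \<le> \<phi> x" "l \<le> l'"
  shows "penalty_fun f \<phi> l x \<le> penalty_fun f \<phi> l' x"
  using assms by (auto simp: penalty_fun_def intro!: add_left_mono mult_right_mono)

text \<open>Where \<open>f x\<close> is finite, a positive \<open>\<phi> x\<close> makes the penalty
  value grow strictly with the parameter; where it is infinite, it exceeds the real number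
  \<open>c\<close> anyway.\<close>

lemma penalty_fun_less:
  assumes "0 < \<phi> x" "l < l'" "f x \<noteq> -\<infinity>" "ereal c \<le> penalty_fun f \<phi> l x"
  shows "ereal c < penalty_fun f \<phi> l' x"
proof (cases "f x")
  case (real t)
  moreover have "l * \<phi> x < l' * \<phi> x"
    using assms by simp
  ultimately show ?thesis
    using assms(4) by (simp add: penalty_fun_def)
qed (use assms in \<open>auto simp: penalty_fun_def\<close>)

text \<open>For real \<open>f x\<close>, clear the positive denominator. For infinite
  \<open>f x\<close> both sides hold, since the quotient is then minus infinity.\<close>

lemma quotient_le_iff_penalty_fun_ge:
  assumes "0 < \<phi> x" "f x \<noteq> -\<infinity>"
  shows "(ereal c - f x) / ereal (\<phi> x) \<le> ereal l \<longleftrightarrow> ereal c \<le> penalty_fun f \<phi> l x"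
  using assms by (cases "f x") (auto simp: penalty_fun_def field_simps)

text \<open>At \<open>l\<close> itself an infeasible point may still attain the value
  \<open>c\<close>. Any larger \<open>l'\<close> lifts every infeasible point strictly above
  \<open>c\<close>, while feasible points keep their values.\<close>

lemma global_minimizers_penalty_fun_eq:
  assumes fin: "\<And>x. f x \<noteq> -\<infinity>" and nonneg: "\<And>x. 0 \<le> \<phi> x"
    and z: "z \<in> global_minimizers f ({x. \<phi> x = 0} \<inter> A)" and c: "f z = ereal c"
    and bound: "\<And>y. y \<in> A \<Longrightarrow> ereal c \<le> penalty_fun f \<phi> l y"
    and "l < l'"
  shows "global_minimizers (penalty_fun f \<phi> l') A = global_minimizers f ({x. \<phi> x = 0} \<inter> A)"
proof (intro set_eqI iffI)
  fix x
  assume x: "x \<in> global_minimizers (penalty_fun f \<phi> l') A"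
  have "penalty_fun f \<phi> l' x \<le> ereal c"
    using x z c by (fastforce simp: global_minimizers_iff)
  then have "\<not> 0 < \<phi> x"
    using penalty_fun_less[of \<phi> x l l' f c] bound[of x] fin \<open>l < l'\<close> x
    by (auto simp: global_minimizers_iff)
  with nonneg[of x] have "\<phi> x = 0" by simp
  with x show "x \<in> global_minimizers f ({x. \<phi> x = 0} \<inter> A)"
    by (fastforce simp: global_minimizers_iff)
next
  fix x
  assume x: "x \<in> global_minimizers f ({x. \<phi> x = 0} \<inter> A)"
  have "f x \<le> ereal c"
    using x z c unfolding global_minimizers_iff by metis
  moreover have "ereal c \<le> penalty_fun f \<phi> l' y" if "y \<in> A" for y
    using bound[OF that] penalty_fun_mono[of \<phi> y l l' f] nonneg[of y] \<open>l < l'\<close>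
    by (meson less_imp_le order_trans)
  ultimately show "x \<in> global_minimizers (penalty_fun f \<phi> l') A"
    using x by (auto simp: global_minimizers_iff intro: order_trans)
qed

lemma globally_exact_iff_bound:
  assumes fin: "\<And>x. f x \<noteq> -\<infinity>" and nonneg: "\<And>x. 0 \<le> \<phi> x"
    and z: "z \<in> global_minimizers f ({x. \<phi> x = 0} \<inter> A)" and c: "f z = ereal c"
  shows "globally_exact f \<phi> {x. \<phi> x = 0} A \<longleftrightarrow>
    (\<exists>l\<ge>0. \<forall>y\<in>A. ereal c \<le> penalty_fun f \<phi> l y)"
proof
  assume "globally_exact f \<phi> {x. \<phi> x = 0} A"
  then obtain l0 where "0 \<le> l0" and
    "\<And>l. l0 < l \<Longrightarrow> global_minimizers (penalty_fun f \<phi> l) A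
                   = global_minimizers f ({x. \<phi> x = 0} \<inter> A)"
    unfolding globally_exact_def by blast
  \<comment> \<open>Exactness speaks only of parameters strictly above \<open>l0\<close>, hence the
    shift by one.\<close>
  then have "z \<in> global_minimizers (penalty_fun f \<phi> (l0 + 1)) A"
    using z by simp
  then have "\<forall>y\<in>A. ereal c \<le> penalty_fun f \<phi> (l0 + 1) y"
    using z c by (simp add: global_minimizers_iff)
  with \<open>0 \<le> l0\<close> show "\<exists>l\<ge>0. \<forall>y\<in>A. ereal c \<le> penalty_fun f \<phi> l y"
    by (intro exI[of _ "l0 + 1"]) simp
next
  assume "\<exists>l\<ge>0. \<forall>y\<in>A. ereal c \<le> penalty_fun f \<phi> l y"
  then show "globally_exact f \<phi> {x. \<phi> x = 0} A"
    unfolding globally_exact_def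
    using global_minimizers_penalty_fun_eq[OF fin nonneg z c] by blast
qed

text \<open>One optimal solution minimizes all penalty functions beyond the threshold, so a constant
  selection serves: it is bounded and at distance zero.\<close>

lemma globally_exact_imp_strongly_nondegenerate:
  assumes "globally_exact f \<phi> M A" "global_minimizers f (M \<inter> A) \<noteq> {}"
  shows "strongly_nondegenerate f \<phi> M A"
proof -
  obtain z where z: "z \<in> global_minimizers f (M \<inter> A)"
    using assms(2) by blast
  obtain l0 where "0 \<le> l0" and
    "\<And>l. l0 < l \<Longrightarrow> global_minimizers (penalty_fun f \<phi> l) A = global_minimizers f (M \<inter> A)"
    using assms(1) unfolding globally_exact_def by blast
  then have "\<forall>l\<ge>l0 + 1. z \<in> global_minimizers (penalty_fun f \<phi> l) A"
    using z by simp
  moreover have "bounded {z |l. l \<ge> l0 + 1}"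
    by (rule bounded_subset[of "{z}"]) auto
  moreover have "infdist z (M \<inter> A) = 0"
    using z by (simp add: global_minimizers_iff)
  ultimately show ?thesis
    unfolding strongly_nondegenerate_def using \<open>0 \<le> l0\<close>
    by (intro exI[of _ "l0 + 1"] conjI exI[of _ "\<lambda>_. z"])
      (simp_all add: Liminf_const zero_ereal_def)
qed

text \<open>The radius \<open>R\<close> is fixed before \<open>L\<close> and \<open>r\<close>, so
  that the values which condition (2) supplies for this \<open>R\<close> can be inserted afterwards.
  A limit inferior of zero gives closeness only for arbitrarily large parameters, not for all large
  ones.\<close>

lemma strongly_nondegenerate_near:
  assumes "strongly_nondegenerate f \<phi> M A"
  obtains R where "0 < R"
    "\<And>L r. 0 < r \<Longrightarrow> \<exists>l\<ge>L. \<exists>x \<in> global_minimizers (penalty_fun f \<phi> l) A.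
       x \<in> cball 0 R \<and> infdist x (M \<inter> A) < r"
proof -
  obtain l0 x where x: "\<And>l. l0 \<le> l \<Longrightarrow> x l \<in> global_minimizers (penalty_fun f \<phi> l) A"
    and bdd: "bounded {x l |l. l \<ge> l0}"
    and lim: "Liminf at_top (\<lambda>l. ereal (infdist (x l) (M \<inter> A))) = 0"
    using assms unfolding strongly_nondegenerate_def by blast
  obtain R where "0 < R" and R: "\<And>l. l0 \<le> l \<Longrightarrow> norm (x l) \<le> R"
    using bdd unfolding bounded_pos by blast
  have "\<exists>l\<ge>max L l0. infdist (x l) (M \<inter> A) < r" if "0 < r" for L r :: real
  proof (rule ccontr)
    assume "\<not> ?thesis"
    then have "\<forall>\<^sub>F l in at_top. ereal r \<le> ereal (infdist (x l) (M \<inter> A))"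
      by (auto simp: not_less intro: eventually_at_top_linorderI[of "max L l0"])
    then have "ereal r \<le> 0"
      using Liminf_bounded lim by metis
    with that show False by simp
  qed
  then show thesis
    using that[of R] \<open>0 < R\<close> x R
    by (metis dist_0_norm max.bounded_iff mem_cball)
qed

theorem theorem3p11:
  fixes f :: "'a::real_normed_vector \<Rightarrow> ereal"
    and \<phi> :: "'a \<Rightarrow> real"
    and M A \<Omega> :: "'a set"
    and fstar :: ereal
  assumes "M \<noteq> {}" and "A \<noteq> {}"
    and "\<And>x. f x \<noteq> -\<infinity>"
    and "\<And>x. 0 \<le> \<phi> x"
    and "M = {x. \<phi> x = 0}"
    and "\<Omega> = M \<inter> A"
    and "\<exists>x\<in>\<Omega>. f x < \<infinity>"
    and "global_minimizers f \<Omega> \<noteq> {}"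
    and "fstar = (INF x\<in>\<Omega>. f x)"
  shows "globally_exact f \<phi> M A \<longleftrightarrow>
    strongly_nondegenerate f \<phi> M A \<and>
    (\<forall>R>0. \<exists>lstar\<ge>0. \<exists>r>0.
       \<forall>y \<in> {x \<in> (A \<inter> cball 0 R) - \<Omega>. infdist x \<Omega> < r}.
         (fstar - f y) / ereal (\<phi> y) \<le> ereal lstar)"
proof -
  note fin = assms(3) and nonneg = assms(4) and M = assms(5) and Om = assms(6)
  obtain z where z: "z \<in> global_minimizers f \<Omega>"
    using assms(8) by blast
  \<comment> \<open>The minimal value lies below some value less than infinity, so it is a real
    number \<open>c\<close>.\<close>
  have "f z < \<infinity>"
    using assms(7) z by (auto simp: global_minimizers_iff)
  with fin[of z] obtain c where c: "f z = ereal c"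
    by (cases "f z") auto
  have fstar: "fstar = ereal c"
    using global_minimizers_INF[OF z] assms(9) c by simp
  have quot: "(fstar - f y) / ereal (\<phi> y) \<le> ereal l \<longleftrightarrow> ereal c \<le> penalty_fun f \<phi> l y"
    if "y \<in> A - \<Omega>" for y l
    unfolding fstar using that nonneg[of y] M Om fin
    by (intro quotient_le_iff_penalty_fun_ge) auto
  have exact_iff: "globally_exact f \<phi> M A \<longleftrightarrow> (\<exists>l\<ge>0. \<forall>y\<in>A. ereal c \<le> penalty_fun f \<phi> l y)"
    using globally_exact_iff_bound[of f \<phi> z A c] fin nonneg z c M Om by simp
  show ?thesis
  proof (intro iffI conjI allI impI)
    assume "globally_exact f \<phi> M A"
    then show "strongly_nondegenerate f \<phi> M A"
      using globally_exact_imp_strongly_nondegenerate assms(8) Om by blast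
  next
    fix R :: real
    assume "globally_exact f \<phi> M A"
    then obtain l where "0 \<le> l" "\<forall>y\<in>A. ereal c \<le> penalty_fun f \<phi> l y"
      using exact_iff by blast
    \<comment> \<open>The bound holds on all of \<open>A\<close>, so any positive \<open>r\<close>
      will do; 1 is chosen.\<close>
    then show "\<exists>lstar\<ge>0. \<exists>r>0. \<forall>y \<in> {x \<in> (A \<inter> cball 0 R) - \<Omega>. infdist x \<Omega> < r}.
         (fstar - f y) / ereal (\<phi> y) \<le> ereal lstar"
      using quot by (intro exI[of _ l] conjI exI[of _ "1::real"]) auto
  next
    assume hyp: "strongly_nondegenerate f \<phi> M A \<and>
      (\<forall>R>0. \<exists>lstar\<ge>0. \<exists>r>0. \<forall>y \<in> {x \<in> (A \<inter> cball 0 R) - \<Omega>. infdist x \<Omega> < r}.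
         (fstar - f y) / ereal (\<phi> y) \<le> ereal lstar)"
    then obtain R where "0 < R" and
      near: "\<And>L r. 0 < r \<Longrightarrow> \<exists>l\<ge>L. \<exists>x \<in> global_minimizers (penalty_fun f \<phi> l) A.
        x \<in> cball 0 R \<and> infdist x (M \<inter> A) < r"
      using strongly_nondegenerate_near by blast
    obtain lstar r where "0 \<le> lstar" "0 < r" and
      est: "\<forall>y \<in> {x \<in> (A \<inter> cball 0 R) - \<Omega>. infdist x \<Omega> < r}.
         (fstar - f y) / ereal (\<phi> y) \<le> ereal lstar"
      using hyp \<open>0 < R\<close> by blast
    \<comment> \<open>The gap above \<open>lstar\<close> turns the bound \<open>c\<close> at an
      infeasible \<open>x\<close> into a strict one, which contradicts the value \<open>c\<close> at
      the feasible point \<open>z\<close>.\<close>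
    obtain l x where "lstar + 1 \<le> l" and x: "x \<in> global_minimizers (penalty_fun f \<phi> l) A"
      and "x \<in> cball 0 R" "infdist x \<Omega> < r"
      using near[OF \<open>0 < r\<close>, of "lstar + 1"] Om by blast
    have "x \<in> A"
      using x by (simp add: global_minimizers_iff)
    have "x \<in> \<Omega>"
    proof (rule ccontr)
      assume "x \<notin> \<Omega>"
      then have "ereal c \<le> penalty_fun f \<phi> lstar x"
        using est quot[of x lstar] \<open>x \<in> A\<close> \<open>x \<in> cball 0 R\<close> \<open>infdist x \<Omega> < r\<close> by blast
      moreover have "0 < \<phi> x"
        using \<open>x \<notin> \<Omega>\<close> \<open>x \<in> A\<close> nonneg[of x] M Om by auto
      ultimately have "ereal c < penalty_fun f \<phi> l x"
        using penalty_fun_less[of \<phi> x lstar l f c] fin \<open>lstar + 1 \<le> l\<close> by simp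
      also have "\<dots> \<le> penalty_fun f \<phi> l z"
        using x z Om by (simp add: global_minimizers_iff)
      also have "\<dots> = ereal c"
        using z c M Om by (simp add: global_minimizers_iff)
      finally show False by simp
    qed
    then have "ereal c \<le> penalty_fun f \<phi> l x"
      using z c M Om by (simp add: global_minimizers_iff)
    \<comment> \<open>Minimality of \<open>x\<close> carries the bound from this single point to all
      of \<open>A\<close>.\<close>
    then have "\<forall>y\<in>A. ereal c \<le> penalty_fun f \<phi> l y"
      using x by (auto simp: global_minimizers_iff intro: order_trans)
    then show "globally_exact f \<phi> M A"
      using exact_iff \<open>0 \<le> lstar\<close> \<open>lstar + 1 \<le> l\<close> by (intro iffD2[OF exact_iff] exI[of _ l]) simp
  qed
qed

end
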